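(* Let $q$ be a complex number with $|q|<1$, with a fixed choice of $q^{1/2}$, and let $k\geq 1$ be an integer. Then $$\sum_{m,n_1,\dots,n_k\ge 0}\frac{q^{\frac{1}{2}m^2+mn_k+(N_1^2+N_2^2+\cdots+N_k^2)+m+N_1+\cdots+N_k}}{(q;q)_{m}(q;q)_{n_1}\cdots(q;q)_{n_{k-1}}(q^2;q^2)_{n_k}} = \frac{(-q^{\frac{1}{2}};q)_\infty(q^{\frac{1}{2}},q^{1+2k},q^{\frac{3}{2}+2k};q^{\frac{3}{2}+2k})_\infty}{(q;q)_\infty},$$ where $N_j=n_j+n_{j+1}+\cdots+n_k$ for $1\le j\le k$.
   Context: For $|q|<1$: $(a;q)_\infty=\prod_{m=0}^\infty(1-aq^m)$, $(a;q)_n=(a;q)_\infty/(aq^n;q)_\infty=\prod_{m=0}^{n-1}(1-aq^m)$ for integers $n\ge0$, and $(a_1,\dots,a_r;q)_\infty=(a_1;q)_\infty\cdots(a_r;q)_\infty$; the same notation is used with the base $q$ replaced by another power of $q$. Half-integer powers of $q$ are understood as integer powers of the fixed square root $q^{1/2}$. *)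

theory Defs
  imports "HOL-Analysis.Analysis"
begin

definition qpoch_inf :: "complex \<Rightarrow> complex \<Rightarrow> complex" where
  "qpoch_inf a q = (\<Prod>m. 1 - a * q ^ m)"

definition qpoch :: "complex \<Rightarrow> complex \<Rightarrow> nat \<Rightarrow> complex" where
  "qpoch a q n = (\<Prod>m<n. 1 - a * q ^ m)"

definition qpoch_inf_list :: "complex list \<Rightarrow> complex \<Rightarrow> complex" where
  "qpoch_inf_list as q = (\<Prod>a\<leftarrow>as. qpoch_inf a q)"

definition tail_sum :: "nat \<Rightarrow> (nat \<Rightarrow> nat) \<Rightarrow> nat \<Rightarrow> nat" where
  "tail_sum k n j = (\<Sum>i=j..k. n i)"

end

theory Submission
  imports Defs
begin

text \<open>
  Write \<open>(a)\<^sub>n\<close> for \<open>(a;q)\<^sub>n\<close>, and \<open>q = s\<^sup>2\<close>. The index \<open>m\<close> enters the summand only through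
  \<open>s^(m\<^sup>2) q^(m n\<^sub>k + m) / (q)\<^sub>m\<close>, so Euler's expansion of \<open>(-z)\<^sub>\<infinity>\<close> with \<open>z = s q^(n\<^sub>k + 1)\<close> sums it
  to \<open>(-s)\<^sub>\<infinity> / (-s)\<^bsub>n\<^sub>k + 1\<^esub>\<close>. What remains is a sum over chains \<open>N\<^sub>1 \<ge> \<dots> \<ge> N\<^sub>k\<close> in which the innermost
  variable carries the weight \<open>\<beta>\<^sub>n = 1 / ((q\<^sup>2;q\<^sup>2)\<^sub>n (-s)\<^bsub>n+1\<^esub>)\<close>. Such a sum is the limit of \<open>k\<close>
  applications of Bailey's lemma, and therefore equals \<open>1/(q)\<^sub>\<infinity>\<close> times \<open>\<Sum>\<^sub>r q^(k(r\<^sup>2+r)) \<alpha>\<^sub>r\<close> as soon as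
  \<open>\<beta>\<close> is matched with some \<open>\<alpha>\<close> in a Bailey pair (\<open>bailey_chain_has_sum\<close>).

  The pair is \<open>\<alpha>\<^sub>r = (-1)^r s^(r(3r+1)/2) (1 - s^(2r+1))\<close>, and this is the one point where something
  specific happens. Cleared of denominators, it is the polynomial identity
  \<open>\<Sum>\<^sub>j (-1)^j s^(j(3j+1)/2) [2n+1, n-j]\<^sub>q = (s)\<^bsub>n+1\<^esub>\<close> between \<open>q\<close>-binomial coefficients
  (\<open>finite_pentagonal\<close>). It is proved with the two \<open>q\<close>-Pascal rules alone: passing from an odd upper
  index to the next even one changes nothing, because the difference is odd under a reflection of \<open>j\<close>,
  and passing from \<open>2n\<close> to \<open>2n+1\<close> multiplies the sum by \<open>1 - s^(2n+1)\<close>, again by a reflection.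

  With this \<open>\<alpha>\<close> the sum \<open>\<Sum>\<^sub>r q^(k(r\<^sup>2+r)) \<alpha>\<^sub>r\<close> is the theta series
  \<open>\<Sum>\<^sub>j (-1)^j x^(j(j+1)/2) y^(j(j-1)/2)\<close> for \<open>x = s^(4k+2)\<close> and \<open>y = s\<close>, and Jacobi's triple product turns
  it into the product with base \<open>x y = s^(4k+3)\<close>. The finite form of the triple product
  follows the same pattern as the identity above, so it too can be read as a Bailey pair; its limit is
  the infinite product. All passages to the limit use the dominated convergence lemma
  \<open>tendsto_sum_dominated\<close>.

  Exponents are kept in the natural numbers throughout, which treats \<open>q = 0\<close> on a par with the other
  values.
\<close>

section \<open>Finite products and Gaussian binomial coefficients\<close>

lemma qpoch_0 [simp]: "qpoch a p 0 = 1"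
  by (simp add: qpoch_def)

lemma qpoch_Suc: "qpoch a p (Suc n) = qpoch a p n * (1 - a * p ^ n)"
  by (simp add: qpoch_def)

lemma qpoch_nonzero:
  assumes "norm p < 1" "norm a < 1"
  shows "qpoch a p n \<noteq> 0"
proof -
  have "1 - a * p ^ m \<noteq> 0" for m
  proof
    assume "1 - a * p ^ m = 0"
    then have "norm (a * p ^ m) = 1" by (metis eq_iff_diff_eq_0 norm_one)
    moreover have "norm (a * p ^ m) \<le> norm a * 1"
      unfolding norm_mult norm_power using assms by (intro mult_left_mono power_le_one) auto
    ultimately show False using assms by simp
  qed
  then show ?thesis by (simp add: qpoch_def)
qed

text \<open>
  The recursion is one of the two \<open>q\<close>-Pascal rules; it makes sense for every \<open>p\<close>, also where the quotient of
  \<open>q\<close>-factorials is of the form \<open>0/0\<close>.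
\<close>

fun qbinomial :: "complex \<Rightarrow> nat \<Rightarrow> nat \<Rightarrow> complex" where
  "qbinomial p n 0 = 1"
| "qbinomial p 0 (Suc k) = 0"
| "qbinomial p (Suc n) (Suc k) = qbinomial p n k + p ^ Suc k * qbinomial p n (Suc k)"

lemma qbinomial_eq_0: "n < k \<Longrightarrow> qbinomial p n k = 0"
  by (induction p n k rule: qbinomial.induct) auto

lemma qbinomial_self [simp]: "qbinomial p n n = 1"
  by (induction n) (auto simp: qbinomial_eq_0)

lemma qbinomial_mult_qpoch:
  "k \<le> n \<Longrightarrow> qbinomial p n k * (qpoch p p k * qpoch p p (n - k)) = qpoch p p n"
proof (induction n arbitrary: k)
  case (Suc n)
  show ?case
  proof (cases k)
    case (Suc l)
    show ?thesis
    proof (cases "l = n")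
      case False
      with Suc Suc.prems have "l < n" by simp
      then obtain d where d: "n = Suc (l + d)" using less_imp_Suc_add by blast
      have 1: "qbinomial p n l * (qpoch p p l * qpoch p p (Suc d)) = qpoch p p n"
        using Suc.IH[of l] d by (simp del: qbinomial.simps)
      have 2: "qbinomial p n (Suc l) * (qpoch p p (Suc l) * qpoch p p d) = qpoch p p n"
        using Suc.IH[of "Suc l"] d by (simp del: qbinomial.simps)
      have "qbinomial p (Suc n) k * (qpoch p p k * qpoch p p (Suc n - k))
          = (1 - p ^ Suc l) * (qbinomial p n l * (qpoch p p l * qpoch p p (Suc d)))
          + p ^ Suc l * (1 - p ^ Suc d) * (qbinomial p n (Suc l) * (qpoch p p (Suc l) * qpoch p p d))"
      proof -
        have sub: "Suc n - Suc l = Suc d" using d by simp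
        have rec: "qpoch p p (Suc d) = qpoch p p d * (1 - p ^ Suc d)"
          "qpoch p p (Suc l) = qpoch p p l * (1 - p ^ Suc l)"
          by (simp_all add: qpoch_Suc)
        show ?thesis
          unfolding Suc qbinomial.simps(3) sub rec by (simp add: algebra_simps del: power_Suc)
      qed
      also have "\<dots> = qpoch p p n * (1 - p * p ^ n)"
      proof -
        have "p ^ Suc l * p ^ Suc d = p * p ^ n" using d by (simp add: power_add)
        then show ?thesis unfolding 1 2 by (simp only: algebra_simps) simp
      qed
      finally show ?thesis by (simp add: qpoch_Suc)
    qed (use Suc in \<open>simp add: qbinomial_eq_0\<close>)
  qed simp
qed simp

lemma qbinomial_eq:
  assumes "norm p < 1" "k \<le> n"
  shows "qbinomial p n k = qpoch p p n / (qpoch p p k * qpoch p p (n - k))"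
  using qbinomial_mult_qpoch[OF assms(2), of p] qpoch_nonzero[OF assms(1) assms(1)]
  by (simp add: field_simps)

lemma qbinomial_symmetric:
  assumes "norm p < 1" "k \<le> n"
  shows "qbinomial p n (n - k) = qbinomial p n k"
  using assms by (simp add: qbinomial_eq mult.commute)

text \<open>
  The two \<open>q\<close>-Pascal rules, in the form in which they act on the coefficients \<open>u\<close> of a sum rather than on
  the binomials. The \<open>q\<close>-binomial theorem, the finite triple product and the identity behind the Bailey
  pair are all obtained by iterating these rules, together with the reflection \<open>k \<mapsto> N - k\<close>.
\<close>

lemma sum_qbinomial_Suc_left:
  "(\<Sum>k\<le>Suc N. u k * qbinomial p (Suc N) k)
     = (\<Sum>k\<le>N. (u (Suc k) + p ^ k * u k) * qbinomial p N k)"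
proof -
  have "(\<Sum>k\<le>Suc N. u k * qbinomial p (Suc N) k)
      = (\<Sum>k\<le>N. u (Suc k) * qbinomial p N k)
        + (u 0 + (\<Sum>k\<le>N. u (Suc k) * p ^ Suc k * qbinomial p N (Suc k)))"
    by (subst sum.atMost_Suc_shift) (simp add: algebra_simps sum.distrib)
  also have "u 0 + (\<Sum>k\<le>N. u (Suc k) * p ^ Suc k * qbinomial p N (Suc k))
      = (\<Sum>k\<le>Suc N. u k * p ^ k * qbinomial p N k)"
    by (subst sum.atMost_Suc_shift) simp
  also have "\<dots> = (\<Sum>k\<le>N. u k * p ^ k * qbinomial p N k)"
    by (simp add: qbinomial_eq_0)
  finally show ?thesis by (simp add: sum.distrib algebra_simps)
qed

lemma sum_qbinomial_reflect:
  assumes "norm p < 1"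
  shows "(\<Sum>k\<le>N. u (N - k) * qbinomial p N k) = (\<Sum>k\<le>N. u k * qbinomial p N k)"
  by (rule sum.reindex_bij_witness[of _ "\<lambda>k. N - k" "\<lambda>k. N - k"])
     (use assms in \<open>auto simp: qbinomial_symmetric\<close>)

lemma sum_qbinomial_Suc_right:
  assumes "norm p < 1"
  shows "(\<Sum>k\<le>Suc N. u k * qbinomial p (Suc N) k)
     = (\<Sum>k\<le>N. (u k + p ^ (N - k) * u (Suc k)) * qbinomial p N k)"
proof -
  have "(\<Sum>k\<le>Suc N. u k * qbinomial p (Suc N) k)
      = (\<Sum>k\<le>Suc N. u (Suc N - k) * qbinomial p (Suc N) k)"
    using sum_qbinomial_reflect[OF assms] by metis
  also have "\<dots> = (\<Sum>k\<le>N. (u (N - k) + p ^ k * u (Suc N - k)) * qbinomial p N k)"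
    using sum_qbinomial_Suc_left[of "\<lambda>k. u (Suc N - k)" p N] by simp
  also have "\<dots> = (\<Sum>k\<le>N. (u (N - k) + p ^ (N - (N - k)) * u (Suc (N - k))) * qbinomial p N k)"
    by (intro sum.cong) (auto simp: Suc_diff_le)
  also have "\<dots> = (\<Sum>k\<le>N. (u k + p ^ (N - k) * u (Suc k)) * qbinomial p N k)"
    using sum_qbinomial_reflect[OF assms, of "\<lambda>k. u k + p ^ (N - k) * u (Suc k)" N] by simp
  finally show ?thesis .
qed

text \<open>
  Here \<open>u\<^sub>k + p^(N-k) u\<^bsub>k+1\<^esub> = (1 + z p^N) u\<^sub>k\<close>, so each application of the Pascal rule splits off one factor.
\<close>

lemma qbinomial_theorem:
  assumes "norm p < 1"
  shows "(\<Sum>k\<le>N. (p ^ (k choose 2) * z ^ k) * qbinomial p N k) = qpoch (- z) p N"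
proof (induction N)
  case (Suc N)
  have "(\<Sum>k\<le>Suc N. (p ^ (k choose 2) * z ^ k) * qbinomial p (Suc N) k)
      = (\<Sum>k\<le>N. ((p ^ (k choose 2) * z ^ k) * qbinomial p N k) * (1 + z * p ^ N))"
    unfolding sum_qbinomial_Suc_right[OF assms]
  proof (intro sum.cong refl)
    fix k assume "k \<in> {..N}"
    then have "p ^ N = p ^ (N - k) * p ^ k" by (simp flip: power_add)
    moreover have "Suc k choose 2 = (k choose 2) + k" by (simp add: numeral_2_eq_2)
    ultimately show "(p ^ (k choose 2) * z ^ k + p ^ (N - k) * (p ^ (Suc k choose 2) * z ^ Suc k)) * qbinomial p N k
      = ((p ^ (k choose 2) * z ^ k) * qbinomial p N k) * (1 + z * p ^ N)"
      by (simp add: algebra_simps power_add)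
  qed
  also have "\<dots> = (\<Sum>k\<le>N. (p ^ (k choose 2) * z ^ k) * qbinomial p N k) * (1 + z * p ^ N)"
    by (simp only: sum_distrib_right)
  finally show ?case using Suc by (simp add: qpoch_Suc)
qed (simp add: numeral_2_eq_2)

section \<open>The finite triple product\<close>

definition msign :: "int \<Rightarrow> complex" where
  "msign j = (if even j then 1 else - 1)"

text \<open>
  Triangular numbers with integer index; since \<open>j(j+1) \<ge> 0\<close> for every integer \<open>j\<close>, nothing is lost by
  taking the value in the natural numbers.
\<close>

definition tri :: "int \<Rightarrow> nat" where
  "tri j = nat (j * (j + 1) div 2)"

lemma tri: "2 * int (tri j) = j * (j + 1)"
proof -
  have "0 \<le> j * (j + 1)" by (cases "j \<ge> 0") (auto simp: zero_le_mult_iff)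
  then show ?thesis unfolding tri_def by simp
qed

definition theta_term :: "complex \<Rightarrow> complex \<Rightarrow> int \<Rightarrow> complex" where
  "theta_term x y j = msign j * x ^ tri j * y ^ tri (j - 1)"

text \<open>
  The quotient of neighbouring theta terms, cleared of negative powers. The exponent \<open>e\<close> will be a
  power of \<open>p = x y\<close> supplied by a Pascal rule.
\<close>

lemma theta_term_down:
  assumes "int e = int n + j"
  shows "(x * y) ^ e * theta_term x y (j - 1) = - y * (x*y) ^ n * theta_term x y j"
proof -
  have "e + tri (j - 1) = n + tri j"
  proof -
    have "int (2 * e + 2 * tri (j - 1)) = int (2 * n + 2 * tri j)"
      using assms tri[of j] tri[of "j - 1"] by (simp add: algebra_simps)
    then show ?thesis by linarith
  qed
  moreover have "e + tri (j - 2) = n + 1 + tri (j - 1)"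
  proof -
    have "int (2 * e + 2 * tri (j - 2)) = int (2 * n + 2 + 2 * tri (j - 1))"
      using assms tri[of "j - 2"] tri[of "j - 1"] by (simp add: algebra_simps)
    then show ?thesis by linarith
  qed
  moreover have "msign (j - 1) = - msign j" by (simp add: msign_def)
  moreover have "(x * y) ^ e * theta_term x y (j - 1)
      = msign (j - 1) * x ^ (e + tri (j - 1)) * y ^ (e + tri (j - 2))"
    by (simp add: theta_term_def power_mult_distrib power_add)
  ultimately show ?thesis
    by (simp add: theta_term_def power_mult_distrib power_add mult_ac)
qed

lemma theta_term_minus: "theta_term x y (- j) = theta_term y x j"
proof -
  have "2 * int (tri (- j)) = 2 * int (tri (j - 1))" "2 * int (tri (- j - 1)) = 2 * int (tri j)"
    unfolding tri by (simp_all add: algebra_simps)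
  then show ?thesis by (simp add: theta_term_def msign_def)
qed

lemma theta_term_up:
  assumes "int e = int n - j"
  shows "(x * y) ^ e * theta_term x y (j + 1) = - x * (x*y) ^ n * theta_term x y j"
proof -
  have "- j - 1 = - (j + 1)" by simp
  then show ?thesis
    using theta_term_down[of e n "- j" y x] assms
    by (simp only: theta_term_minus mult.commute[of y x])
qed

text \<open>
  With \<open>j = n - k\<close>, the Pascal rules combine \<open>t\<^sub>j\<close> with \<open>p^(n+j) t\<^bsub>j-1\<^esub>\<close> and with \<open>p^(n-j) t\<^bsub>j+1\<^esub>\<close>, which are
  multiples of \<open>t\<^sub>j\<close> by constants independent of \<open>j\<close>. Hence the sums with upper index \<open>2n\<close> and \<open>2n+1\<close>
  (\<open>E\<close> and \<open>D\<close>) acquire alternately the factors \<open>1 - y p^n\<close> and \<open>1 - x p^n\<close>.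
\<close>

lemma finite_triple_product:
  assumes "norm (x * y) < 1"
  shows "(\<Sum>k\<le>2*n+1. theta_term x y (int n - int k) * qbinomial (x * y) (2*n+1) k)
     = qpoch x (x * y) n * qpoch y (x * y) (Suc n)"
proof -
  define p where "p = x * y"
  define t where "t = theta_term x y"
  have p: "norm p < 1" using assms by (simp add: p_def)
  define E where "E n = (\<Sum>k\<le>2*n. t (int n - int k) * qbinomial p (2*n) k)" for n
  define D where "D n = (\<Sum>k\<le>2*n+1. t (int n - int k) * qbinomial p (2*n+1) k)" for n
  have D: "D n = (1 - y * p ^ n) * E n" for n
  proof -
    have "t (int n - int k) + p ^ (2 * n - k) * t (int n - int (Suc k)) = (1 - y * p ^ n) * t (int n - int k)"
      if "k \<le> 2 * n" for k
      using theta_term_down[of "2 * n - k" n "int n - int k" x y] that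
      by (simp add: t_def p_def algebra_simps of_nat_diff)
    then show ?thesis unfolding D_def E_def sum_distrib_left
      using sum_qbinomial_Suc_right[OF p, of "\<lambda>k. t (int n - int k)" "2*n"]
      by (simp add: mult.assoc)
  qed
  have E: "E (Suc n) = (1 - x * p ^ n) * D n" for n
  proof -
    have "t (int n - int k) + p ^ k * t (int (Suc n) - int k) = (1 - x * p ^ n) * t (int n - int k)" for k
      using theta_term_up[of k n "int n - int k" x y]
      by (simp add: t_def p_def algebra_simps)
    then show ?thesis unfolding D_def E_def sum_distrib_left
      using sum_qbinomial_Suc_left[of "\<lambda>k. t (int (Suc n) - int k)" p "2*n+1"]
      by (simp add: mult.assoc)
  qed
  have "E n = qpoch x p n * qpoch y p n"
  proof (induction n)
    case 0 show ?case by (simp add: E_def t_def theta_term_def msign_def tri_def)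
  next
    case (Suc n) then show ?case by (simp add: E D qpoch_Suc)
  qed
  then have "D n = qpoch x p n * qpoch y p (Suc n)"
    by (simp add: D qpoch_Suc)
  then show ?thesis by (simp add: D_def p_def t_def)
qed

section \<open>The identity behind the Bailey pair\<close>

definition pent :: "int \<Rightarrow> nat" where
  "pent j = nat (j * (3 * j + 1) div 2)"

lemma pent: "2 * int (pent j) = j * (3 * j + 1)"
proof -
  have "0 \<le> j * (3 * j + 1)" by (cases "j \<ge> 0") (auto simp: zero_le_mult_iff)
  moreover have "even (j * (3 * j + 1))" by simp
  ultimately show ?thesis unfolding pent_def by simp
qed

text \<open>
  The exponents grow like \<open>3j\<^sup>2/2\<close> while the base is \<open>p = s\<^sup>2\<close>, so neighbouring terms are no longer
  proportional as in the triple product. Instead, the Pascal rules produce terms that are mirror images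
  of others: \<open>p^(n+j) t\<^bsub>j-1\<^esub> = - s^(2n+1) t\<^bsub>-j\<^esub>\<close>, and \<open>s^(-2j) t\<^sub>j\<close> changes sign under \<open>j \<mapsto> 1 - j\<close>. As the
  binomials are symmetric, the first fact gives the factor \<open>1 - s^(2n+1)\<close> in the step from \<open>2n\<close> to \<open>2n+1\<close>,
  and the second makes the extra terms in the step from \<open>2n+1\<close> to \<open>2n+2\<close> cancel.
\<close>

lemma finite_pentagonal:
  assumes "norm (s ^ 2) < 1"
  shows "(\<Sum>k\<le>2*n+1. (msign (int n - int k) * s ^ pent (int n - int k)) * qbinomial (s ^ 2) (2*n+1) k)
     = qpoch s (s ^ 2) (Suc n)"
proof -
  define p where "p = s ^ 2"
  have p: "norm p < 1" using assms by (simp add: p_def)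
  define t where "t j = msign j * s ^ pent j" for j
  define E where "E n = (\<Sum>k\<le>2*n. t (int n - int k) * qbinomial p (2*n) k)" for n
  define D where "D n = (\<Sum>k\<le>2*n+1. t (int n - int k) * qbinomial p (2*n+1) k)" for n
  have D: "D n = (1 - s * p ^ n) * E n" for n
  proof -
    have t: "p ^ (2 * n - k) * t (int n - int (Suc k)) = - s * p ^ n * t (int n - int (2 * n - k))"
      if "k \<le> 2 * n" for k
    proof -
      define e where "e = 2 * n - k"
      define j where "j = int n - int k"
      have e: "int e = int n + j" using that by (simp add: e_def j_def)
      have "int (4 * e + 2 * pent (j - 1)) = int (2 * (2 * n + 1) + 2 * pent (- j))"
        using e pent[of "j - 1"] pent[of "- j"] by (simp add: algebra_simps)
      then have "4 * e + 2 * pent (j - 1) = 2 * (2 * n + 1) + 2 * pent (- j)"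
        by (simp only: of_nat_eq_iff)
      then have "2 * e + pent (j - 1) = (2 * n + 1) + pent (- j)" by simp
      then have "s ^ (2 * e) * s ^ pent (j - 1) = s * s ^ (2 * n) * s ^ pent (- j)"
        by (simp flip: power_add)
      then have "p ^ e * t (j - 1) = - s * p ^ n * t (- j)"
        by (simp add: t_def msign_def p_def flip: power_mult)
      then show ?thesis using that by (simp add: j_def e_def of_nat_diff algebra_simps)
    qed
    have "D n = (\<Sum>k\<le>2*n. (t (int n - int k) + p ^ (2 * n - k) * t (int n - int (Suc k))) * qbinomial p (2 * n) k)"
      unfolding D_def using sum_qbinomial_Suc_right[OF p, of "\<lambda>k. t (int n - int k)" "2*n"] by simp
    also have "\<dots> = (\<Sum>k\<le>2*n. t (int n - int k) * qbinomial p (2 * n) k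
        - s * p ^ n * (t (int n - int (2 * n - k)) * qbinomial p (2 * n) k))"
      by (intro sum.cong refl, subst t) (auto simp: algebra_simps)
    also have "\<dots> = E n - s * p ^ n * E n"
      unfolding sum_subtractf E_def
      using sum_qbinomial_reflect[OF p, of "\<lambda>k. t (int n - int k)" "2 * n"]
      by (simp flip: sum_distrib_left)
    finally show ?thesis by (simp add: algebra_simps)
  qed
  have E: "E (Suc n) = D n" for n
  proof -
    \<comment> \<open>the terms added by the Pascal rule; they cancel in pairs under the reflection \<open>k \<mapsto> 2n+1-k\<close>\<close>
    define v where "v k = p ^ k * t (int n - int k + 1)" for k
    have v: "v (2 * n + 1 - k) = - v k" if "k \<le> 2 * n + 1" for k
    proof -
      define e where "e = 2 * n + 1 - k"
      define j where "j = int n - int k + 1"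
      have e: "int e + 1 - j = int n + 1" "int k + j = int n + 1" using that by (auto simp: e_def j_def)
      have "int (4 * e + 2 * pent (1 - j)) = int (4 * k + 2 * pent j)"
        using e pent[of "1 - j"] pent[of "j"] by (simp add: algebra_simps)
      then have "2 * e + pent (1 - j) = 2 * k + pent j" by linarith
      then have "s ^ (2 * e) * s ^ pent (1 - j) = s ^ (2 * k) * s ^ pent j"
        by (simp flip: power_add)
      then have "p ^ e * t (1 - j) = - (p ^ k * t j)"
        by (simp add: t_def msign_def p_def flip: power_mult)
      moreover have "int n - int (2 * n + 1 - k) + 1 = 1 - j" using that by (simp add: j_def)
      ultimately show ?thesis by (simp add: v_def e_def j_def)
    qed
    define S where "S = (\<Sum>k\<le>2*n+1. v k * qbinomial p (2*n+1) k)"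
    have "S = (\<Sum>k\<le>2*n+1. v (2*n+1-k) * qbinomial p (2*n+1) k)"
      unfolding S_def by (rule sum_qbinomial_reflect[OF p, symmetric])
    also have "\<dots> = - S"
      unfolding S_def sum_negf[symmetric] by (intro sum.cong refl, subst v) auto
    finally have "S + S = 0" by (metis add.right_inverse)
    then have "S = 0" by (simp flip: mult_2)
    moreover have "E (Suc n) = (\<Sum>k\<le>2*n+1. (t (int n - int k) + v k) * qbinomial p (2*n+1) k)"
      unfolding E_def v_def
      using sum_qbinomial_Suc_left[of "\<lambda>k. t (int (Suc n) - int k)" p "2*n+1"]
      by (simp add: algebra_simps)
    ultimately show ?thesis by (simp only: D_def S_def algebra_simps sum.distrib add_0_left)
  qed
  have "E n = qpoch s p n"
  proof (induction n)
    case 0 show ?case by (simp add: E_def t_def msign_def pent_def)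
  next
    case (Suc n) then show ?case by (simp add: E D qpoch_Suc)
  qed
  then have "D n = qpoch s p (Suc n)"
    by (simp add: D qpoch_Suc)
  then show ?thesis by (simp add: D_def p_def t_def)
qed

section \<open>Bailey pairs\<close>

text \<open>
  The involution \<open>j \<mapsto> -1 - j\<close> of the integers has the natural numbers as a fundamental domain; folding along
  it turns bilateral sums with coefficients symmetric under the involution into sums over \<open>r \<ge> 0\<close>.
\<close>

definition fold_int :: "(int \<Rightarrow> complex) \<Rightarrow> nat \<Rightarrow> complex" where
  "fold_int t r = t (int r) + t (- int r - 1)"

text \<open>
  A Bailey pair relative to \<open>a = q\<close>. Usually the second denominator is \<open>(q\<^sup>2)\<^bsub>n+r\<^esub>\<close>; taking
  \<open>(q)\<^bsub>n+r+1\<^esub> = (1-q) (q\<^sup>2)\<^bsub>n+r\<^esub>\<close> moves the constant \<open>1-q\<close> into \<open>\<alpha>\<close>, and the sum becomes that of a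
  bilateral sequence against \<open>[2n+1, n-r]\<close>.
\<close>

definition bailey_pair :: "complex \<Rightarrow> (nat \<Rightarrow> complex) \<Rightarrow> (nat \<Rightarrow> complex) \<Rightarrow> bool" where
  "bailey_pair q \<alpha> \<beta> \<longleftrightarrow>
     (\<forall>n. \<beta> n = (\<Sum>r\<le>n. \<alpha> r / (qpoch q q (n - r) * qpoch q q (n + r + 1))))"

text \<open>
  Replacing \<open>k\<close> by \<open>2n+1-k\<close> fixes the binomial and sends \<open>j = n-k\<close> to \<open>-1-j\<close>, so the identities of the
  previous sections for odd upper index are Bailey pairs in disguise.
\<close>

lemma sum_odd_qbinomial_fold:
  assumes "norm p < 1"
  shows "(\<Sum>k\<le>2*n+1. t (int n - int k) * qbinomial p (2*n+1) k)
    = qpoch p p (2*n+1) * (\<Sum>r\<le>n. fold_int t r / (qpoch p p (n - r) * qpoch p p (n + r + 1)))"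
proof -
  define f where "f k = t (int n - int k) * qbinomial p (2*n+1) k" for k
  define w where "w r = qpoch p p (2*n+1) / (qpoch p p (n - r) * qpoch p p (n + r + 1))" for r
  have "(\<Sum>k\<le>2*n+1. f k) = (\<Sum>k\<le>n. f k) + (\<Sum>k=n+1..2*n+1. f k)"
  proof -
    have "{..2*n+1} = {..n} \<union> {n+1..2*n+1}" by auto
    then show ?thesis by (simp only: sum.union_disjoint finite_atMost finite_atLeastAtMost) (subst sum.union_disjoint, auto)
  qed
  also have "(\<Sum>k\<le>n. f k) = (\<Sum>r\<le>n. t (int r) * w r)"
    by (rule sum.reindex_bij_witness[of _ "\<lambda>r. n - r" "\<lambda>r. n - r"])
       (use assms in \<open>auto simp: f_def w_def qbinomial_eq of_nat_diff mult_2 Suc_diff_le\<close>)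
  also have "(\<Sum>k=n+1..2*n+1. f k) = (\<Sum>r\<le>n. f (n + r + 1))"
    by (rule sum.reindex_bij_witness[of _ "\<lambda>r. n + r + 1" "\<lambda>k. k - n - 1"]) auto
  also have "\<dots> = (\<Sum>r\<le>n. t (- int r - 1) * w r)"
  proof (intro sum.cong refl)
    fix r assume "r \<in> {..n}"
    then have "2 * n + 1 - (n + r + 1) = n - r" "n + r + 1 \<le> 2 * n + 1"
      "int n - int (n + r + 1) = - int r - 1"
      by auto
    then show "f (n + r + 1) = t (- int r - 1) * w r"
      using assms unfolding f_def w_def by (simp only: qbinomial_eq mult.commute)
  qed
  finally show ?thesis
    by (simp add: f_def w_def fold_int_def sum_distrib_left add_divide_distrib sum.distrib algebra_simps
        flip: sum.distrib)
qed

text \<open>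
  Among the \<open>2n+1\<close> factors \<open>1 - s^(2i)\<close> of the left side, those with \<open>i\<close> odd factor as
  \<open>(1 - s^i)(1 + s^i)\<close>, and those with \<open>i\<close> even form the product with base \<open>s^4\<close>.
\<close>

lemma qpoch_square_split:
  "qpoch (s ^ 2) (s ^ 2) (2*n+1)
    = qpoch s (s ^ 2) (n+1) * qpoch (- s) (s ^ 2) (n+1) * qpoch ((s ^ 2) ^ 2) ((s ^ 2) ^ 2) n"
proof (induction n)
  case 0
  show ?case by (simp add: qpoch_Suc power2_eq_square algebra_simps)
next
  case (Suc n)
  define P where "P = s ^ (2 * n)"
  have e: "2 * Suc n + 1 = Suc (Suc (2 * n + 1))" "Suc n + 1 = Suc (n + 1)" by simp_all
  have P: "(s ^ 2) ^ (2 * n + 1) = P * P * s ^ 2" "(s ^ 2) ^ Suc (2 * n + 1) = P * P * s ^ 4"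
    "(s ^ 2) ^ (n + 1) = P * s ^ 2" "((s ^ 2) ^ 2) ^ n = P * P"
    unfolding P_def power_mult[symmetric] power_add[symmetric]
    by (intro arg_cong[where f = "\<lambda>e. s ^ e"]; simp)+
  show ?case
    unfolding e qpoch_Suc[of _ _ "Suc (2 * n + 1)"] qpoch_Suc[of _ _ "2 * n + 1"]
       qpoch_Suc[of _ _ "n + 1"] qpoch_Suc[of _ _ "n"] Suc P
    by (simp add: algebra_simps power4_eq_xxxx power2_eq_square)
qed

lemma bailey_pair_pentagonal:
  fixes s q :: complex
  assumes "norm q < 1" "s ^ 2 = q"
  shows "bailey_pair q (fold_int (\<lambda>j. msign j * s ^ pent j))
     (\<lambda>n. 1 / (qpoch (q ^ 2) (q ^ 2) n * qpoch (- s) q (n + 1)))"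
  unfolding bailey_pair_def
proof
  fix n
  have "norm s < 1"
    using assms by (metis norm_power power_less1_D zero_less_numeral norm_ge_zero real_norm_def power_less_one_iff)
  then have nz: "qpoch q q (2*n+1) \<noteq> 0" "qpoch s q (n+1) \<noteq> 0"
    by (intro qpoch_nonzero assms; assumption)+
  have "qpoch q q (2*n+1) * (\<Sum>r\<le>n. fold_int (\<lambda>j. msign j * s ^ pent j) r / (qpoch q q (n - r) * qpoch q q (n + r + 1)))
    = qpoch s q (n + 1)"
    using finite_pentagonal[of s n] sum_odd_qbinomial_fold[of q "\<lambda>j. msign j * s ^ pent j" n] assms by simp
  moreover have "qpoch q q (2*n+1) = qpoch s q (n+1) * qpoch (- s) q (n+1) * qpoch (q ^ 2) (q ^ 2) n"
    using qpoch_square_split[of s n] assms by simp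
  ultimately show "1 / (qpoch (q ^ 2) (q ^ 2) n * qpoch (- s) q (n + 1))
    = (\<Sum>r\<le>n. fold_int (\<lambda>j. msign j * s ^ pent j) r / (qpoch q q (n - r) * qpoch q q (n + r + 1)))"
    using nz by (simp add: field_simps)
qed

text \<open>
  A case of the \<open>q\<close>-Vandermonde sum, and the engine of Bailey's lemma. The induction rests on
  \<open>1 - q^(M+1) = (1 - q^(M+1-i)) + q^(M+1-i) (1 - q^i)\<close>: the first part cancels a factor of
  \<open>(q)\<^bsub>M+1-i\<^esub>\<close>, the second one of \<open>(q)\<^sub>i\<close>, which after a shift of \<open>i\<close> raises \<open>c\<close> by one.
\<close>

lemma q_vandermonde:
  assumes q: "norm q < 1"
  shows "(\<Sum>i\<le>M. q ^ (i * (i + c)) / (qpoch q q (M - i) * qpoch q q i * qpoch q q (i + c)))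
     = 1 / (qpoch q q M * qpoch q q (M + c))"
proof (induction M arbitrary: c)
  case 0
  then show ?case by simp
next
  case (Suc M)
  define f where "f N c i = q ^ (i * (i + c)) / (qpoch q q (N - i) * qpoch q q i * qpoch q q (i + c))" for N c i
  note nz = qpoch_nonzero[OF q q]
  have fac: "1 - q ^ Suc n \<noteq> 0" for n
    using nz[of "Suc n"] by (simp add: qpoch_Suc)
  have 1: "(1 - q ^ (Suc M - i)) * f (Suc M) c i = (if i \<le> M then f M c i else 0)" if "i \<le> Suc M" for i
  proof (cases "i \<le> M")
    case True
    then have "Suc M - i = Suc (M - i)" by simp
    then show ?thesis using True fac[of "M - i"] by (simp add: f_def qpoch_Suc)
  qed (use that in simp)
  have 2: "q ^ (Suc M - Suc i) * (1 - q ^ Suc i) * f (Suc M) c (Suc i) = q ^ (Suc M + c) * f M (Suc c) i"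
    if "i \<le> M" for i
  proof -
    have "(M - i) + Suc i * (Suc i + c) = (Suc M + c) + i * (i + Suc c)"
      using that by (simp add: algebra_simps)
    then have "q ^ (M - i) * q ^ (Suc i * (Suc i + c)) = q ^ (Suc M + c) * q ^ (i * (i + Suc c))"
      by (metis power_add)
    moreover have "q ^ (M - i) * (1 - q ^ Suc i) * f (Suc M) c (Suc i)
        = q ^ (M - i) * q ^ (Suc i * (Suc i + c)) / (qpoch q q (M - i) * qpoch q q i * qpoch q q (i + Suc c))"
      using fac[of i] by (simp add: f_def qpoch_Suc[of _ _ i])
    ultimately show ?thesis by (simp add: f_def)
  qed
  have "(1 - q ^ Suc M) * (\<Sum>i\<le>Suc M. f (Suc M) c i)
      = (\<Sum>i\<le>Suc M. (1 - q ^ (Suc M - i)) * f (Suc M) c i)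
      + (\<Sum>i\<le>Suc M. q ^ (Suc M - i) * (1 - q ^ i) * f (Suc M) c i)"
    unfolding sum_distrib_left sum.distrib[symmetric]
    by (intro sum.cong refl) (auto simp: algebra_simps simp flip: power_add power_Suc)
  also have "(\<Sum>i\<le>Suc M. (1 - q ^ (Suc M - i)) * f (Suc M) c i) = (\<Sum>i\<le>M. f M c i)"
    using 1 by (simp)
  also have "(\<Sum>i\<le>Suc M. q ^ (Suc M - i) * (1 - q ^ i) * f (Suc M) c i)
      = q ^ (Suc M + c) * (\<Sum>i\<le>M. f M (Suc c) i)"
  proof -
    have "(\<Sum>i\<le>M. q ^ (Suc M - Suc i) * (1 - q ^ Suc i) * f (Suc M) c (Suc i))
        = (\<Sum>i\<le>M. q ^ (Suc M + c) * f M (Suc c) i)"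
      by (intro sum.cong refl 2) simp
    then show ?thesis
      unfolding sum_distrib_left by (subst sum.atMost_Suc_shift) simp
  qed
  also have "(\<Sum>i\<le>M. f M c i) = 1 / (qpoch q q M * qpoch q q (M + c))"
    unfolding f_def by (rule Suc.IH)
  also have "(\<Sum>i\<le>M. f M (Suc c) i) = 1 / (qpoch q q M * qpoch q q (Suc (M + c)))"
    unfolding f_def Suc.IH by simp
  also have "1 / (qpoch q q M * qpoch q q (M + c)) + q ^ (Suc M + c) * (1 / (qpoch q q M * qpoch q q (Suc (M + c))))
     = 1 / (qpoch q q M * qpoch q q (Suc (M + c)))"
    using nz[of M] nz[of "M + c"] fac[of "M + c"] by (simp add: qpoch_Suc divide_simps)
  finally have "(\<Sum>i\<le>Suc M. f (Suc M) c i) = 1 / (qpoch q q M * qpoch q q (Suc (M + c))) / (1 - q ^ Suc M)"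
    using fac[of M] by (simp only: nonzero_eq_divide_eq mult.commute not_False_eq_True)
  also have "\<dots> = 1 / (qpoch q q (Suc M) * qpoch q q (Suc M + c))"
    by (simp add: qpoch_Suc[of q q M] mult_ac)
  finally show ?case unfolding f_def .
qed

text \<open>
  The action of Bailey's lemma on \<open>\<beta>\<close> when both of its parameters are sent to infinity.
\<close>

definition bailey_step :: "complex \<Rightarrow> (nat \<Rightarrow> complex) \<Rightarrow> nat \<Rightarrow> complex" where
  "bailey_step q \<beta> n = (\<Sum>i\<le>n. q ^ (i ^ 2 + i) * \<beta> i / qpoch q q (n - i))"

text \<open>
  Bailey's lemma: after the definition of \<open>\<beta>\<close> is inserted and the order of summation exchanged, the
  inner sum over \<open>l = i - r\<close> is the \<open>q\<close>-Vandermonde sum with \<open>c = 2r+1\<close>, because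
  \<open>(r+l)\<^sup>2 + (r+l) = (r\<^sup>2+r) + l(l+2r+1)\<close>.
\<close>

lemma bailey_pair_step:
  assumes q: "norm q < 1" and "bailey_pair q \<alpha> \<beta>"
  shows "bailey_pair q (\<lambda>r. q ^ (r ^ 2 + r) * \<alpha> r) (bailey_step q \<beta>)"
  unfolding bailey_pair_def
proof
  fix n
  define G where "G r l = q ^ ((r + l) ^ 2 + (r + l)) / qpoch q q (n - (r + l))
       * (\<alpha> r / (qpoch q q l * qpoch q q (l + 2 * r + 1)))" for r l
  have "bailey_step q \<beta> n = (\<Sum>i\<le>n. \<Sum>r\<le>i. G r (i - r))"
    unfolding bailey_step_def
  proof (intro sum.cong refl)
    fix i
    have "\<beta> i = (\<Sum>r\<le>i. \<alpha> r / (qpoch q q (i - r) * qpoch q q (i + r + 1)))"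
      using assms by (simp add: bailey_pair_def)
    then have "q ^ (i ^ 2 + i) * \<beta> i / qpoch q q (n - i) = q ^ (i ^ 2 + i) / qpoch q q (n - i)
        * (\<Sum>r\<le>i. \<alpha> r / (qpoch q q (i - r) * qpoch q q (i + r + 1)))"
      by simp
    also have "\<dots> = (\<Sum>r\<le>i. q ^ (i ^ 2 + i) / qpoch q q (n - i) * (\<alpha> r / (qpoch q q (i - r) * qpoch q q (i + r + 1))))"
      by (rule sum_distrib_left)
    also have "\<dots> = (\<Sum>r\<le>i. G r (i - r))"
      by (rule sum.cong) (auto simp: G_def mult_2)
    finally show "q ^ (i ^ 2 + i) * \<beta> i / qpoch q q (n - i) = (\<Sum>r\<le>i. G r (i - r))" .
  qed
  also have "\<dots> = (\<Sum>(r, l)\<in>{(r, l). r + l \<le> n}. G r l)"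
    by (rule sum.triangle_reindex_eq[symmetric])
  also have "{(r, l). r + l \<le> n} = (SIGMA r:{..n}. {..n - r})" by auto
  also have "(\<Sum>(r, l)\<in>\<dots>. G r l) = (\<Sum>r\<le>n. \<Sum>l\<le>n - r. G r l)"
    by (rule sum.Sigma[symmetric]) auto
  also have "\<dots> = (\<Sum>r\<le>n. q ^ (r ^ 2 + r) * \<alpha> r / (qpoch q q (n - r) * qpoch q q (n + r + 1)))"
  proof (intro sum.cong refl)
    fix r assume "r \<in> {..n}"
    then have n: "n - r + (2 * r + 1) = n + r + 1" by simp
    have G: "G r l = q ^ (r ^ 2 + r) * \<alpha> r *
       (q ^ (l * (l + (2 * r + 1))) / (qpoch q q (n - r - l) * qpoch q q l * qpoch q q (l + (2 * r + 1))))" for l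
    proof -
      have "(r + l) ^ 2 + (r + l) = (r ^ 2 + r) + l * (l + (2 * r + 1))"
        by (simp add: power2_eq_square algebra_simps)
      then have e: "q ^ ((r + l) ^ 2 + (r + l)) = q ^ (r ^ 2 + r) * q ^ (l * (l + (2 * r + 1)))"
        by (simp only: power_add)
      show ?thesis unfolding G_def e by (simp add: add.assoc mult.assoc)
    qed
    show "(\<Sum>l\<le>n - r. G r l) = q ^ (r ^ 2 + r) * \<alpha> r / (qpoch q q (n - r) * qpoch q q (n + r + 1))"
      unfolding G sum_distrib_left[symmetric] q_vandermonde[OF q] n by simp
  qed
  finally show "bailey_step q \<beta> n = (\<Sum>r\<le>n. q ^ (r ^ 2 + r) * \<alpha> r / (qpoch q q (n - r) * qpoch q q (n + r + 1)))" .
qed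

section \<open>Limits\<close>

lemma convergent_prod_qpoch:
  fixes a q :: complex
  assumes "norm q < 1"
  shows "convergent_prod (\<lambda>m. 1 - a * q ^ m)"
proof (rule abs_convergent_prod_imp_convergent_prod, rule summable_imp_abs_convergent_prod)
  have "summable (\<lambda>m. norm a * norm q ^ m)"
    using assms by (intro summable_mult summable_geometric) simp
  then show "summable (\<lambda>m. norm (1 - a * q ^ m - 1))"
    by (simp add: norm_mult norm_power)
qed

lemma qpoch_tendsto:
  assumes "norm q < 1"
  shows "qpoch a q \<longlonglongrightarrow> qpoch_inf a q"
proof -
  have "(\<lambda>n. \<Prod>m\<le>n. 1 - a * q ^ m) \<longlonglongrightarrow> qpoch_inf a q"
    unfolding qpoch_inf_def by (rule convergent_prod_LIMSEQ[OF convergent_prod_qpoch[OF assms]])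
  then have "(\<lambda>n. qpoch a q (Suc n)) \<longlonglongrightarrow> qpoch_inf a q"
    by (simp add: qpoch_def lessThan_Suc_atMost)
  then show ?thesis by (simp only: filterlim_sequentially_Suc)
qed

lemma qpoch_inf_nonzero:
  assumes "norm q < 1" "norm a < 1"
  shows "qpoch_inf a q \<noteq> 0"
  unfolding qpoch_inf_def
proof (rule prodinf_nonzero[OF convergent_prod_qpoch[OF assms(1)]])
  fix m
  show "1 - a * q ^ m \<noteq> 0"
    using qpoch_nonzero[OF assms, of "Suc m"] by (simp add: qpoch_Suc)
qed

lemma inverse_qpoch_bounded:
  assumes "norm q < 1" "norm a < 1"
  obtains C where "C > 0" "\<And>n. norm (1 / qpoch a q n) \<le> C"
proof -
  have "(\<lambda>n. 1 / qpoch a q n) \<longlonglongrightarrow> 1 / qpoch_inf a q"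
    by (intro tendsto_intros qpoch_tendsto qpoch_inf_nonzero assms)
  then have "Bseq (\<lambda>n. 1 / qpoch a q n)"
    by (rule convergentI[THEN convergent_imp_Bseq])
  then show ?thesis using that by (auto simp: Bseq_def)
qed

text \<open>
  Tannery's theorem for sums whose range grows with the parameter.
\<close>

lemma tendsto_sum_dominated:
  fixes a :: "nat \<Rightarrow> complex"
  assumes "summable (\<lambda>r. norm (a r))"
    and "\<And>n r. r \<le> n \<Longrightarrow> norm (c n r) \<le> C"
    and "\<And>r. (\<lambda>n. c n r) \<longlonglongrightarrow> d r"
  shows "(\<lambda>n. \<Sum>r\<le>n. a r * c n r) \<longlonglongrightarrow> (\<Sum>r. a r * d r)"
proof -
  define A where "A r n = (if r \<le> n then a r * c n r else 0)" for r n
  have "(\<lambda>n. suminf (\<lambda>r. A r n)) \<longlonglongrightarrow> suminf (\<lambda>r. a r * d r)"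
  proof (rule tannerys_theorem[THEN conjunct2, THEN conjunct2])
    fix r
    have "(\<lambda>n. a r * c n r) \<longlonglongrightarrow> a r * d r" by (intro tendsto_intros assms)
    moreover have "eventually (\<lambda>n. A r n = a r * c n r) sequentially"
      using eventually_ge_at_top[of r] by eventually_elim (simp add: A_def)
    ultimately show "A r \<longlonglongrightarrow> a r * d r"
      by (simp add: filterlim_cong)
  next
    have "0 \<le> C" using assms(2)[of 0 0] norm_ge_zero order_trans by blast
    then show "eventually (\<lambda>(r, n). norm (A r n) \<le> norm (a r) * C) (sequentially \<times>\<^sub>F sequentially)"
      by (intro always_eventually) (auto simp: A_def norm_mult intro!: mult_left_mono assms)
    show "summable (\<lambda>r. norm (a r) * C)" by (intro summable_mult2 assms)
  qed simp
  moreover have "suminf (\<lambda>r. A r n) = (\<Sum>r\<le>n. a r * c n r)" for n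
    by (subst suminf_finite[of "{..n}"]) (auto simp: A_def)
  ultimately show ?thesis by simp
qed

lemma tendsto_diff_const_nat:
  fixes f :: "nat \<Rightarrow> 'a :: topological_space"
  assumes "f \<longlonglongrightarrow> L"
  shows "(\<lambda>n. f (n - r)) \<longlonglongrightarrow> L"
  by (rule filterlim_compose[OF assms filterlim_minus_const_nat_at_top])

lemma bailey_pair_tendsto:
  assumes q: "norm q < 1" and "bailey_pair q \<alpha> \<beta>" "summable (\<lambda>r. norm (\<alpha> r))"
  shows "\<beta> \<longlonglongrightarrow> (\<Sum>r. \<alpha> r) / qpoch_inf q q ^ 2"
proof -
  obtain C where C: "C > 0" "\<And>n. norm (1 / qpoch q q n) \<le> C"
    using inverse_qpoch_bounded[OF q q] by blast
  have "(\<lambda>n. \<Sum>r\<le>n. \<alpha> r * (1 / qpoch q q (n - r) * (1 / qpoch q q (n + r + 1))))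
     \<longlonglongrightarrow> (\<Sum>r. \<alpha> r * (1 / qpoch_inf q q * (1 / qpoch_inf q q)))"
  proof (rule tendsto_sum_dominated[OF assms(3)])
    show "norm (1 / qpoch q q (n - r) * (1 / qpoch q q (n + r + 1))) \<le> C * C" for n r
      unfolding norm_mult by (intro mult_mono C) (use C in auto)
    have lim: "(\<lambda>n. qpoch q q (n + (r + 1))) \<longlonglongrightarrow> qpoch_inf q q" for r
      by (rule LIMSEQ_ignore_initial_segment[OF qpoch_tendsto[OF q]])
    show "(\<lambda>n. 1 / qpoch q q (n - r) * (1 / qpoch q q (n + r + 1)))
       \<longlonglongrightarrow> 1 / qpoch_inf q q * (1 / qpoch_inf q q)" for r
      using lim[of r]
      by (intro tendsto_intros tendsto_diff_const_nat qpoch_tendsto qpoch_inf_nonzero q) (auto simp: add.assoc)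
  qed
  moreover have "\<beta> = (\<lambda>n. \<Sum>r\<le>n. \<alpha> r * (1 / qpoch q q (n - r) * (1 / qpoch q q (n + r + 1))))"
    using assms by (simp add: bailey_pair_def fun_eq_iff)
  moreover have "(\<Sum>r. \<alpha> r * (1 / qpoch_inf q q * (1 / qpoch_inf q q))) = (\<Sum>r. \<alpha> r) / qpoch_inf q q ^ 2"
    using suminf_divide[OF summable_norm_cancel[OF assms(3)], of "qpoch_inf q q ^ 2"]
    by (simp add: power2_eq_square)
  ultimately show ?thesis by simp
qed

lemma summable_norm_power_mult_bounded:
  fixes b :: "nat \<Rightarrow> complex"
  assumes "norm q < 1" "\<And>n. norm (b n) \<le> B" "\<And>n. n \<le> e n"
  shows "summable (\<lambda>n. norm (q ^ e n * b n))"
proof (rule summable_comparison_test')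
  show "summable (\<lambda>n. norm q ^ n * B)"
    using assms by (intro summable_mult2 summable_geometric) simp
  show "norm (norm (q ^ e n * b n)) \<le> norm q ^ n * B" if "n \<ge> 0" for n
    using assms by (auto simp: norm_mult norm_power intro!: mult_mono power_decreasing)
qed

text \<open>
  This and \<open>bailey_pair_tendsto\<close> evaluate the same limit from the two sides of a Bailey pair.
\<close>

lemma bailey_step_tendsto:
  assumes q: "norm q < 1" and "\<And>n. norm (\<beta> n) \<le> B"
  shows "bailey_step q \<beta> \<longlonglongrightarrow> (\<Sum>n. q ^ (n ^ 2 + n) * \<beta> n) / qpoch_inf q q"
proof -
  obtain C where C: "C > 0" "\<And>n. norm (1 / qpoch q q n) \<le> C"
    using inverse_qpoch_bounded[OF q q] by blast
  have sm: "summable (\<lambda>n. norm (q ^ (n ^ 2 + n) * \<beta> n))"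
    using assms by (rule summable_norm_power_mult_bounded) simp
  have "(\<lambda>n. \<Sum>i\<le>n. (q ^ (i ^ 2 + i) * \<beta> i) * (1 / qpoch q q (n - i)))
     \<longlonglongrightarrow> (\<Sum>i. (q ^ (i ^ 2 + i) * \<beta> i) * (1 / qpoch_inf q q))"
    by (rule tendsto_sum_dominated[OF sm C(2)])
       (intro tendsto_intros tendsto_diff_const_nat qpoch_tendsto qpoch_inf_nonzero q)
  then show ?thesis
    using suminf_mult2[OF summable_norm_cancel[OF sm], of "1 / qpoch_inf q q"]
    by (simp add: bailey_step_def[abs_def])
qed

lemma bailey_step_bounded:
  assumes q: "norm q < 1" and "\<And>n. norm (\<beta> n) \<le> B"
  obtains B' where "\<And>n. norm (bailey_step q \<beta> n) \<le> B'"
proof -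
  have "Bseq (bailey_step q \<beta>)"
    by (rule convergent_imp_Bseq[OF convergentI[OF bailey_step_tendsto[OF assms]]])
  then show ?thesis using that by (auto simp: Bseq_def)
qed

lemma bailey_lemma_limit:
  assumes q: "norm q < 1" and "bailey_pair q \<alpha> \<beta>" "summable (\<lambda>r. norm (\<alpha> r))"
    and "\<And>n. norm (\<beta> n) \<le> B"
  shows "(\<Sum>n. q ^ (n ^ 2 + n) * \<beta> n) = (\<Sum>r. q ^ (r ^ 2 + r) * \<alpha> r) / qpoch_inf q q"
proof -
  have "summable (\<lambda>r. norm (q ^ (r ^ 2 + r) * \<alpha> r))"
    by (rule summable_comparison_test'[OF assms(3)])
       (use q in \<open>auto simp: norm_mult norm_power intro!: mult_left_le_one_le power_le_one\<close>)
  then have "bailey_step q \<beta> \<longlonglongrightarrow> (\<Sum>r. q ^ (r ^ 2 + r) * \<alpha> r) / qpoch_inf q q ^ 2"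
    using bailey_pair_tendsto[OF q bailey_pair_step[OF assms(1,2)]] by simp
  from LIMSEQ_unique[OF this bailey_step_tendsto[OF q assms(4)]]
  show ?thesis using qpoch_inf_nonzero[OF q q] by (simp add: power2_eq_square field_simps)
qed

text \<open>
  The limit \<open>N \<rightarrow> \<infinity>\<close> of the \<open>q\<close>-binomial theorem, in which \<open>[N, m]\<close> tends to \<open>1/(q)\<^sub>m\<close>.
\<close>

lemma euler_qexp:
  assumes q: "norm q < 1"
    and z: "norm z < 1"
  shows "(\<lambda>m. q ^ (m choose 2) * z ^ m / qpoch q q m) sums qpoch_inf (- z) q"
    and "summable (\<lambda>m. norm (q ^ (m choose 2) * z ^ m / qpoch q q m))"
proof -
  obtain C where C: "C > 0" "\<And>n. norm (1 / qpoch q q n) \<le> C"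
    using inverse_qpoch_bounded[OF q q] by blast
  have "Bseq (qpoch q q)"
    by (rule convergent_imp_Bseq[OF convergentI[OF qpoch_tendsto[OF q]]])
  then obtain D where D: "D > 0" "\<And>n. norm (qpoch q q n) \<le> D" by (auto simp: Bseq_def)
  define a where "a m = q ^ (m choose 2) * z ^ m / qpoch q q m" for m
  show sm: "summable (\<lambda>m. norm (a m))"
  proof (rule summable_comparison_test')
    show "summable (\<lambda>m. norm z ^ m * C)"
      using z by (intro summable_mult2 summable_geometric) simp
    show "norm (norm (a m)) \<le> norm z ^ m * C" if "m \<ge> 0" for m
    proof -
      have "norm (a m) = norm q ^ (m choose 2) * (norm z ^ m * norm (1 / qpoch q q m))"
        by (simp add: a_def norm_mult norm_divide norm_power)
      also have "\<dots> \<le> 1 * (norm z ^ m * C)"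
        using q C by (intro mult_mono power_le_one) auto
      finally show ?thesis by simp
    qed
  qed
  have "(\<lambda>n. \<Sum>m\<le>n. a m * (qpoch q q n * (1 / qpoch q q (n - m))))
     \<longlonglongrightarrow> (\<Sum>m. a m * (qpoch_inf q q * (1 / qpoch_inf q q)))"
  proof (rule tendsto_sum_dominated[OF sm])
    show "norm (qpoch q q n * (1 / qpoch q q (n - m))) \<le> D * C" for n m
      unfolding norm_mult by (intro mult_mono C D) (use C D in auto)
    show "(\<lambda>n. qpoch q q n * (1 / qpoch q q (n - m))) \<longlonglongrightarrow> qpoch_inf q q * (1 / qpoch_inf q q)" for m
      by (intro tendsto_intros tendsto_diff_const_nat qpoch_tendsto qpoch_inf_nonzero q)
  qed
  moreover have "(\<Sum>m\<le>n. a m * (qpoch q q n * (1 / qpoch q q (n - m)))) = qpoch (- z) q n" for n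
    unfolding qbinomial_theorem[OF q, symmetric]
    by (intro sum.cong refl) (use q in \<open>simp add: qbinomial_eq a_def\<close>)
  ultimately have "qpoch (- z) q \<longlonglongrightarrow> (\<Sum>m. a m)"
    using qpoch_inf_nonzero[OF q q] by simp
  from LIMSEQ_unique[OF this qpoch_tendsto[OF q]]
  show "a sums qpoch_inf (- z) q"
    using summable_sums[OF summable_norm_cancel[OF sm]] by simp
qed

lemma summable_norm_theta:
  assumes "norm x < 1" "norm y < 1"
  shows "summable (\<lambda>r. norm (fold_int (theta_term x y) r))"
proof (rule summable_comparison_test')
  show "summable (\<lambda>r. norm x ^ r + norm y ^ r)"
    using assms by (intro summable_add summable_geometric) auto
  fix r :: nat
  have b: "norm (theta_term u v (int n)) \<le> norm u ^ n" if "norm u < 1" "norm v < 1" for u v n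
  proof -
    have "2 * int (tri (int n)) \<ge> 2 * int n"
      unfolding tri by (cases n) (auto simp: algebra_simps)
    then have "norm u ^ tri (int n) \<le> norm u ^ n"
      using that by (intro power_decreasing) auto
    moreover have "norm v ^ tri (int n - 1) \<le> 1" using that by (intro power_le_one) auto
    ultimately have "norm u ^ tri (int n) * norm v ^ tri (int n - 1) \<le> norm u ^ n * 1"
      by (intro mult_mono) auto
    then show ?thesis by (simp add: theta_term_def msign_def norm_mult norm_power)
  qed
  have "norm (theta_term x y (- int r - 1)) = norm (theta_term y x (int (Suc r)))"
  proof -
    have "- int r - 1 = - int (Suc r)" by simp
    then show ?thesis by (simp only: theta_term_minus)
  qed
  also have "\<dots> \<le> norm y ^ Suc r" by (rule b[OF assms(2,1)])
  also have "\<dots> \<le> norm y ^ r" using assms by (intro power_decreasing) auto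
  finally show "norm (norm (fold_int (theta_term x y) r)) \<le> norm x ^ r + norm y ^ r"
    using b[OF assms, of r] norm_triangle_ineq[of "theta_term x y (int r)" "theta_term x y (- int r - 1)"]
    by (simp add: fold_int_def)
qed

text \<open>
  The finite triple product says that \<open>\<beta>\<^sub>n = (x)\<^sub>n (y)\<^bsub>n+1\<^esub> / (p)\<^bsub>2n+1\<^esub>\<close>, with base \<open>p = x y\<close>, forms a Bailey
  pair with the folded theta terms. The limit of \<open>\<beta>\<close> is obtained directly from the products and
  once more from the pair; comparing the two gives the theorem.
\<close>

lemma jacobi_triple_product:
  assumes "norm x < 1" "norm y < 1"
  shows "(\<Sum>r. fold_int (theta_term x y) r)
     = qpoch_inf x (x * y) * qpoch_inf y (x * y) * qpoch_inf (x * y) (x * y)"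
proof -
  define p where "p = x * y"
  have p: "norm p < 1"
    using assms mult_strict_mono'[of "norm x" 1 "norm y" 1] by (simp add: p_def norm_mult)
  define \<beta> where "\<beta> n = qpoch x p n * qpoch y p (n + 1) / qpoch p p (2 * n + 1)" for n
  have "bailey_pair p (fold_int (theta_term x y)) \<beta>"
    unfolding bailey_pair_def
  proof
    fix n
    show "\<beta> n = (\<Sum>r\<le>n. fold_int (theta_term x y) r / (qpoch p p (n - r) * qpoch p p (n + r + 1)))"
      using finite_triple_product[of x y n] sum_odd_qbinomial_fold[OF p, of "theta_term x y" n] p
        qpoch_nonzero[OF p p, of "2 * n + 1"]
      by (simp add: \<beta>_def p_def[symmetric] field_simps)
  qed
  then have 1: "\<beta> \<longlonglongrightarrow> (\<Sum>r. fold_int (theta_term x y) r) / qpoch_inf p p ^ 2"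
    using bailey_pair_tendsto[OF p] summable_norm_theta[OF assms] by blast
  have sub: "(\<lambda>n. qpoch p p (2 * n + 1)) \<longlonglongrightarrow> qpoch_inf p p"
    using LIMSEQ_subseq_LIMSEQ[OF qpoch_tendsto[OF p], of "\<lambda>n. 2 * n + 1"]
    by (simp add: o_def strict_mono_def)
  have "\<beta> \<longlonglongrightarrow> qpoch_inf x p * qpoch_inf y p / qpoch_inf p p"
    unfolding \<beta>_def
    by (intro tendsto_intros qpoch_tendsto p LIMSEQ_ignore_initial_segment sub qpoch_inf_nonzero)
  from LIMSEQ_unique[OF this 1] show ?thesis
    using qpoch_inf_nonzero[OF p p] by (simp add: p_def power2_eq_square field_simps)
qed

section \<open>The Bailey chain as a multiple sum\<close>

text \<open>
  The multiple sum with an arbitrary weight \<open>\<beta>\<close> at the innermost variable \<open>n\<^sub>k\<close>. Leaving \<open>\<beta>\<close> free is what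
  allows induction on \<open>k\<close>: a level of the chain is absorbed into the weight.
\<close>

definition bailey_chain_term :: "complex \<Rightarrow> nat \<Rightarrow> (nat \<Rightarrow> complex) \<Rightarrow> (nat \<Rightarrow> nat) \<Rightarrow> complex" where
  "bailey_chain_term q k \<beta> n =
     q ^ (\<Sum>j=1..k. tail_sum k n j ^ 2 + tail_sum k n j) / (\<Prod>j=1..<k. qpoch q q (n j)) * \<beta> (n k)"

text \<open>
  Since \<open>N\<^sub>j \<ge> n\<^sub>j\<close>, the terms are dominated by a product of geometric series, one for each \<open>n\<^sub>j\<close>.
\<close>

lemma bailey_chain_term_abs_summable:
  assumes q: "norm q < 1" and \<beta>: "\<And>n. norm (\<beta> n) \<le> B"
  shows "(\<lambda>n. norm (bailey_chain_term q k \<beta> n)) summable_on ({1..k} \<rightarrow>\<^sub>E UNIV)"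
proof -
  obtain C where C: "C > 0" "\<And>n. norm (1 / qpoch q q n) \<le> C"
    using inverse_qpoch_bounded[OF q q] by blast
  define g where "g n = (\<Prod>j\<in>{1..k}. norm q ^ n j)" for n :: "nat \<Rightarrow> nat"
  have "Infinite_Set_Sum.abs_summable_on (\<lambda>i. norm q ^ i) (UNIV :: nat set)"
    using q by (intro abs_summable_on_nat_iff'[THEN iffD2]) (simp add: norm_power summable_geometric)
  then have "Infinite_Set_Sum.abs_summable_on g ({1..k} \<rightarrow>\<^sub>E UNIV)"
    unfolding g_def by (intro abs_summable_on_prod_PiE) auto
  then have "(\<lambda>n. norm (g n)) summable_on ({1..k} \<rightarrow>\<^sub>E UNIV)"
    by (simp only: abs_summable_equivalent)
  moreover have "norm (g n) = g n" for n by (simp add: g_def prod_nonneg)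
  ultimately have "(\<lambda>n. C ^ (k - 1) * B * g n) summable_on ({1..k} \<rightarrow>\<^sub>E UNIV)"
    by (intro summable_on_cmult_right) simp
  then show ?thesis
  proof (rule Infinite_Sum.abs_summable_on_comparison_test')
    fix n :: "nat \<Rightarrow> nat"
    have "(\<Sum>j\<in>{1..k}. n j) \<le> (\<Sum>j=1..k. tail_sum k n j ^ 2 + tail_sum k n j)"
    proof (rule sum_mono)
      fix j assume "j \<in> {1..k}"
      then have "n j \<le> tail_sum k n j"
        unfolding tail_sum_def by (intro member_le_sum) auto
      then show "n j \<le> tail_sum k n j ^ 2 + tail_sum k n j" by simp
    qed
    then have 1: "norm q ^ (\<Sum>j=1..k. tail_sum k n j ^ 2 + tail_sum k n j) \<le> g n"
      unfolding g_def power_sum[symmetric] using q by (intro power_decreasing) auto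
    have 2: "(\<Prod>j=1..<k. norm (1 / qpoch q q (n j))) \<le> C ^ (k - 1)"
      using prod_mono[of "{1..<k}" "\<lambda>j. norm (1 / qpoch q q (n j))" "\<lambda>_. C"] C(2) by auto
    have "norm (bailey_chain_term q k \<beta> n) = norm q ^ (\<Sum>j=1..k. tail_sum k n j ^ 2 + tail_sum k n j)
        * (\<Prod>j=1..<k. norm (1 / qpoch q q (n j))) * norm (\<beta> (n k))"
      by (simp add: bailey_chain_term_def norm_mult norm_divide norm_power prod_norm prod_dividef flip: prod_norm)
    also have "\<dots> \<le> g n * C ^ (k - 1) * B"
      using C by (intro mult_mono 1 2 \<beta>) (auto simp: g_def prod_nonneg)
    finally show "norm (bailey_chain_term q k \<beta> n) \<le> C ^ (k - 1) * B * g n" by (simp add: mult_ac)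
  qed
qed

text \<open>
  The substitution that removes the last variable: \<open>(n\<^sub>k, n\<^bsub>k+1\<^esub>)\<close> is recovered from the sum
  \<open>n\<^sub>k + n\<^bsub>k+1\<^esub>\<close>, which is the last variable of a chain of length \<open>k\<close>, and \<open>i = n\<^bsub>k+1\<^esub>\<close>.
  It leaves \<open>N\<^sub>1, \<dots>, N\<^sub>k\<close> unchanged.
\<close>

definition split_last :: "nat \<Rightarrow> (nat \<Rightarrow> nat) \<Rightarrow> nat \<Rightarrow> nat \<Rightarrow> nat" where
  "split_last k n i = n(k := n k - i, Suc k := i)"

lemma bij_betw_split_last:
  assumes "k \<ge> 1"
  shows "bij_betw (\<lambda>(n, i). split_last k n i)
    (SIGMA n:{1..k} \<rightarrow>\<^sub>E UNIV. {..n k}) ({1..Suc k} \<rightarrow>\<^sub>E UNIV)"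
  by (rule bij_betwI[where g = "\<lambda>n. ((restrict n {1..k})(k := n k + n (Suc k)), n (Suc k))"])
     (use assms in \<open>auto simp: split_last_def PiE_def extensional_def fun_eq_iff\<close>)

lemma bailey_chain_term_split_last:
  assumes "k \<ge> 1" "i \<le> n k"
  shows "bailey_chain_term q (Suc k) \<beta> (split_last k n i)
    = q ^ (\<Sum>j=1..k. tail_sum k n j ^ 2 + tail_sum k n j) / (\<Prod>j=1..<k. qpoch q q (n j))
      * (q ^ (i ^ 2 + i) * \<beta> i / qpoch q q (n k - i))"
proof -
  have T: "tail_sum (Suc k) (split_last k n i) j = tail_sum k n j" if "j \<in> {1..k}" for j
  proof -
    have "{j..Suc k} = insert (Suc k) (insert k {j..<k})" "{j..k} = insert k {j..<k}"
      using that by auto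
    then show ?thesis using assms by (simp add: tail_sum_def split_last_def)
  qed
  have T': "tail_sum (Suc k) (split_last k n i) (Suc k) = i"
    by (simp add: tail_sum_def split_last_def)
  have "(\<Prod>j=1..<Suc k. qpoch q q (split_last k n i j)) = (\<Prod>j=1..<k. qpoch q q (n j)) * qpoch q q (n k - i)"
    using assms by (simp add: prod.atLeastLessThan_Suc split_last_def)
  moreover have "(\<Sum>j=1..Suc k. tail_sum (Suc k) (split_last k n i) j ^ 2 + tail_sum (Suc k) (split_last k n i) j)
     = (\<Sum>j=1..k. tail_sum k n j ^ 2 + tail_sum k n j) + (i ^ 2 + i)"
    using T T' by simp
  ultimately show ?thesis
    by (simp only: bailey_chain_term_def power_add) (simp add: split_last_def)
qed

text \<open>
  Summing over \<open>i\<close> at fixed \<open>N\<^sub>1, \<dots>, N\<^sub>k\<close> is a finite sum, and it is exactly one Bailey step applied to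
  the weight.
\<close>

lemma bailey_chain_term_has_sum_Suc:
  assumes q: "norm q < 1" and \<beta>: "\<And>n. norm (\<beta> n) \<le> B" and k: "k \<ge> 1"
    and S: "(bailey_chain_term q k (bailey_step q \<beta>) has_sum S) ({1..k} \<rightarrow>\<^sub>E UNIV)"
  shows "(bailey_chain_term q (Suc k) \<beta> has_sum S) ({1..Suc k} \<rightarrow>\<^sub>E UNIV)"
proof -
  define h where "h = (\<lambda>x. bailey_chain_term q (Suc k) \<beta> ((\<lambda>(n, i). split_last k n i) x))"
  note bij = bij_betw_split_last[OF k]
  have "bailey_chain_term q (Suc k) \<beta> summable_on ({1..Suc k} \<rightarrow>\<^sub>E UNIV)"
    by (rule abs_summable_summable[OF bailey_chain_term_abs_summable[OF q \<beta>]])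
  then have sm: "h summable_on (SIGMA n:{1..k} \<rightarrow>\<^sub>E UNIV. {..n k})"
    unfolding h_def summable_on_reindex_bij_betw[OF bij] .
  have "(h has_sum S) (SIGMA n:{1..k} \<rightarrow>\<^sub>E UNIV. {..n k})"
  proof (rule has_sum_SigmaI[OF _ S sm])
    fix n assume "n \<in> {1..k} \<rightarrow>\<^sub>E (UNIV :: nat set)"
    have "(\<Sum>i\<le>n k. h (n, i)) = bailey_chain_term q k (bailey_step q \<beta>) n"
      unfolding h_def bailey_chain_term_def[of q k] bailey_step_def sum_distrib_left
      using k by (auto intro!: sum.cong simp: bailey_chain_term_split_last)
    then show "((\<lambda>i. h (n, i)) has_sum bailey_chain_term q k (bailey_step q \<beta>) n) {..n k}"
      by (intro has_sum_finiteI) auto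
  qed
  then show ?thesis
    unfolding h_def has_sum_reindex_bij_betw[OF bij] .
qed

text \<open>
  All levels but one are absorbed by Bailey steps, each of which multiplies \<open>\<alpha>\<^sub>r\<close> by \<open>q^(r\<^sup>2+r)\<close>; the
  remaining single sum over \<open>N\<^sub>1\<close> is the limiting case of Bailey's lemma.
\<close>

theorem bailey_chain_has_sum:
  assumes q: "norm q < 1" and "bailey_pair q \<alpha> \<beta>" "summable (\<lambda>r. norm (\<alpha> r))"
    and "\<And>n. norm (\<beta> n) \<le> B" and "k \<ge> 1"
  shows "(bailey_chain_term q k \<beta> has_sum (\<Sum>r. q ^ (k * (r ^ 2 + r)) * \<alpha> r) / qpoch_inf q q)
     ({1..k} \<rightarrow>\<^sub>E UNIV)"
  using assms(5,2,3,4)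
proof (induction k arbitrary: \<alpha> \<beta> B rule: nat_induct_at_least)
  case base
  define e :: "nat \<Rightarrow> nat \<Rightarrow> nat" where "e i = (\<lambda>j\<in>{1}. i)" for i
  have bij: "bij_betw e UNIV ({1..1} \<rightarrow>\<^sub>E UNIV)"
  proof (rule bij_betwI[where g = "\<lambda>n. n 1"])
    fix n :: "nat \<Rightarrow> nat" assume n: "n \<in> {1..1} \<rightarrow>\<^sub>E UNIV"
    show "e (n 1) = n"
    proof
      fix j show "e (n 1) j = n j"
        by (cases "j = 1") (use n in \<open>auto simp: e_def PiE_iff extensional_def\<close>)
    qed
  qed (auto simp: e_def)
  have sm: "summable (\<lambda>n. norm (q ^ (n ^ 2 + n) * \<beta> n))"
    using q base(3) by (rule summable_norm_power_mult_bounded) simp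
  have "((\<lambda>n. q ^ (n ^ 2 + n) * \<beta> n) has_sum (\<Sum>n. q ^ (n ^ 2 + n) * \<beta> n)) UNIV"
    by (rule norm_summable_imp_has_sum[OF sm summable_sums[OF summable_norm_cancel[OF sm]]])
  also note bailey_lemma_limit[OF q base]
  also have "(\<lambda>n. q ^ (n ^ 2 + n) * \<beta> n) = (\<lambda>n. bailey_chain_term q 1 \<beta> (e n))"
    by (simp add: bailey_chain_term_def tail_sum_def e_def)
  finally show ?case
    unfolding has_sum_reindex_bij_betw[OF bij] by simp
next
  case (Suc k)
  define \<alpha>' where "\<alpha>' r = q ^ (r ^ 2 + r) * \<alpha> r" for r
  have "summable (\<lambda>r. norm (\<alpha>' r))"
    by (rule summable_comparison_test'[OF Suc.prems(2)])
       (use q in \<open>auto simp: \<alpha>'_def norm_mult norm_power intro!: mult_left_le_one_le power_le_one\<close>)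
  moreover have "bailey_pair q \<alpha>' (bailey_step q \<beta>)"
    unfolding \<alpha>'_def by (rule bailey_pair_step[OF q Suc.prems(1)])
  moreover obtain B' where "\<And>n. norm (bailey_step q \<beta> n) \<le> B'"
    using bailey_step_bounded[of q \<beta> B, OF q Suc.prems(3)] by blast
  ultimately have "(bailey_chain_term q k (bailey_step q \<beta>) has_sum
      (\<Sum>r. q ^ (k * (r ^ 2 + r)) * \<alpha>' r) / qpoch_inf q q) ({1..k} \<rightarrow>\<^sub>E UNIV)"
    by (intro Suc.IH)
  then have "(bailey_chain_term q (Suc k) \<beta> has_sum (\<Sum>r. q ^ (k * (r ^ 2 + r)) * \<alpha>' r) / qpoch_inf q q) ({1..Suc k} \<rightarrow>\<^sub>E UNIV)"
    by (rule bailey_chain_term_has_sum_Suc[OF q Suc.prems(3) Suc.hyps])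
  then show ?case by (simp add: \<alpha>'_def power_add mult_ac)
qed

section \<open>The identity\<close>

lemma qpoch_inf_split:
  assumes q: "norm q < 1"
  shows "qpoch_inf a q = qpoch a q n * qpoch_inf (a * q ^ n) q"
proof -
  have "qpoch a q (m + n) = qpoch a q n * qpoch (a * q ^ n) q m" for m
    by (induction m) (simp_all add: qpoch_Suc power_add mult_ac)
  then have "(\<lambda>m. qpoch a q n * qpoch (a * q ^ n) q m) \<longlonglongrightarrow> qpoch_inf a q"
    using LIMSEQ_ignore_initial_segment[OF qpoch_tendsto[OF q], of a n] by simp
  moreover have "(\<lambda>m. qpoch a q n * qpoch (a * q ^ n) q m) \<longlonglongrightarrow> qpoch a q n * qpoch_inf (a * q ^ n) q"
    by (intro tendsto_intros qpoch_tendsto q)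
  ultimately show ?thesis by (rule LIMSEQ_unique)
qed

text \<open>
  Both \<open>j = r\<close> and \<open>j = -r-1\<close> satisfy \<open>j(j+1) = r\<^sup>2+r\<close>, so \<open>q^(k(r\<^sup>2+r))\<close> may be distributed over the two
  terms of the fold, and then the exponents of \<open>s\<close> agree:
  \<open>2k j(j+1) + j(3j+1)/2 = (4k+2) j(j+1)/2 + j(j-1)/2\<close>.
\<close>

lemma theta_term_eq_pent:
  "s ^ (2 * k * (r ^ 2 + r)) * fold_int (\<lambda>j. msign j * s ^ pent j) r
    = fold_int (theta_term (s ^ (4 * k + 2)) s) r"
proof -
  have "s ^ (2 * k * (r ^ 2 + r)) * (msign j * s ^ pent j) = theta_term (s ^ (4 * k + 2)) s j"
    if "j * (j + 1) = int (r ^ 2 + r)" for j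
  proof -
    have "2 * (int (2 * k) * int (r ^ 2 + r)) + 2 * int (pent j)
       = int (4 * k + 2) * (2 * int (tri j)) + 2 * int (tri (j - 1))"
      unfolding that[symmetric] pent tri by (simp add: algebra_simps)
    then have "int (2 * (2 * k * (r ^ 2 + r) + pent j)) = int (2 * ((4 * k + 2) * tri j + tri (j - 1)))"
      by (simp add: algebra_simps)
    then have "2 * k * (r ^ 2 + r) + pent j = (4 * k + 2) * tri j + tri (j - 1)"
      by (simp only: of_nat_eq_iff mult_cancel1) simp
    then have "s ^ (2 * k * (r ^ 2 + r)) * s ^ pent j = (s ^ (4 * k + 2)) ^ tri j * s ^ tri (j - 1)"
      by (metis power_add power_mult)
    then show ?thesis by (simp add: theta_term_def)
  qed
  from this[of "int r"] this[of "- int r - 1"] show ?thesis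
    by (simp add: fold_int_def distrib_left power2_eq_square algebra_simps)
qed

text \<open>
  The absolute convergence that justifies summing over \<open>m\<close> first comes from \<open>|q^(m n\<^sub>k + m)| \<le> 1\<close>, which
  separates \<open>m\<close> from the other variables.
\<close>

theorem corollary4p3:
  fixes q s :: complex and k :: nat
  assumes "norm q < 1" and "s ^ 2 = q" and "k \<ge> 1"
  shows "((\<lambda>(m, n).
            s ^ (m ^ 2) * q ^ (m * n k + (\<Sum>j=1..k. (tail_sum k n j) ^ 2) + m + (\<Sum>j=1..k. tail_sum k n j))
            / (qpoch q q m * (\<Prod>j=1..<k. qpoch q q (n j)) * qpoch (q ^ 2) (q ^ 2) (n k)))
          has_sum
            (qpoch_inf (- s) q
             * qpoch_inf_list [s, q ^ (1 + 2 * k), s ^ (3 + 4 * k)] (s ^ (3 + 4 * k))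
             / qpoch_inf q q))
          ((UNIV :: nat set) \<times> ({1..k} \<rightarrow>\<^sub>E (UNIV :: nat set)))" (is "(?f has_sum ?S) _")
proof -
  note q = assms(1)
  have s: "norm s < 1"
    using assms by (metis norm_power power_less_one_iff norm_ge_zero zero_less_numeral)
  have q2: "norm (q ^ 2) < 1" using q by (simp add: norm_power power_less_one_iff)
  define a where "a z m = q ^ (m choose 2) * z ^ m / qpoch q q m" for z m
  define \<gamma> where "\<gamma> n = 1 / qpoch (q ^ 2) (q ^ 2) n" for n
  define \<beta> where "\<beta> n = 1 / (qpoch (q ^ 2) (q ^ 2) n * qpoch (- s) q (n + 1))" for n
  define \<alpha> where "\<alpha> = fold_int (\<lambda>j. msign j * s ^ pent j)"
  \<comment> \<open>\<open>s^(m\<^sup>2)\<close> is \<open>q^(m(m-1)/2) s^m\<close>, which brings the sum over \<open>m\<close> into Euler's form\<close>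
  have f: "?f (m, n) = a (s * q ^ (n k + 1)) m * bailey_chain_term q k \<gamma> n" for m n
  proof -
    have "2 * (m choose 2) + m = m ^ 2"
      by (induction m) (auto simp: numeral_2_eq_2)
    then have "s ^ (m ^ 2) = (s ^ 2) ^ (m choose 2) * s ^ m"
      by (metis power_add power_mult)
    then have "s ^ (m ^ 2) = q ^ (m choose 2) * s ^ m" by (simp only: assms(2))
    moreover have "q ^ (m * n k) = (q ^ n k) ^ m" by (metis power_mult mult.commute)
    ultimately show ?thesis
      by (simp add: a_def bailey_chain_term_def \<gamma>_def sum.distrib power_add power_mult_distrib mult_ac)
  qed
  obtain C where C: "\<And>n. norm (\<gamma> n) \<le> C"
    using inverse_qpoch_bounded[OF q2 q2] unfolding \<gamma>_def by blast
  obtain D where D: "D > 0" "\<And>n. norm (1 / qpoch (- s) q n) \<le> D"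
    using inverse_qpoch_bounded[OF q, of "- s"] s by auto
  have \<beta>: "norm (\<beta> n) \<le> C * D" for n
  proof -
    have "\<beta> n = \<gamma> n * (1 / qpoch (- s) q (n + 1))" by (simp add: \<beta>_def \<gamma>_def)
    then show ?thesis
      by (simp only: norm_mult) (intro mult_mono C D norm_ge_zero order_trans[OF norm_ge_zero C[of n]])
  qed
  \<comment> \<open>Euler's sum is \<open>(-s q^(n\<^sub>k+1))\<^sub>\<infinity> = (-s)\<^sub>\<infinity> / (-s)\<^bsub>n\<^sub>k+1\<^esub>\<close>, and its denominator turns the weight \<open>\<gamma>\<close> into \<open>\<beta>\<close>\<close>
  have inner: "((\<lambda>m. ?f (m, n)) has_sum qpoch_inf (- s) q * bailey_chain_term q k \<beta> n) UNIV" for n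
  proof -
    define z where "z = s * q ^ (n k + 1)"
    have "norm z \<le> norm s * 1"
      unfolding z_def norm_mult norm_power using q by (intro mult_left_mono power_le_one) auto
    then have "norm z < 1" using s by simp
    then have "(a z has_sum qpoch_inf (- z) q) UNIV"
      unfolding a_def by (intro norm_summable_imp_has_sum euler_qexp q)
    then have "((\<lambda>m. a z m * bailey_chain_term q k \<gamma> n) has_sum qpoch_inf (- z) q * bailey_chain_term q k \<gamma> n) UNIV"
      by (rule has_sum_cmult_left)
    moreover have "qpoch_inf (- z) q * bailey_chain_term q k \<gamma> n = qpoch_inf (- s) q * bailey_chain_term q k \<beta> n"
      using qpoch_inf_split[OF q, of "- s" "n k + 1"] qpoch_nonzero[OF q, of "- s" "n k + 1"] s
      by (simp add: bailey_chain_term_def \<beta>_def \<gamma>_def z_def)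
    ultimately show ?thesis unfolding f z_def by simp
  qed
  have "(\<Sum>r. q ^ (k * (r ^ 2 + r)) * \<alpha> r)
      = qpoch_inf_list [s, q ^ (1 + 2 * k), s ^ (3 + 4 * k)] (s ^ (3 + 4 * k))"
  proof -
    have "q ^ (k * (r ^ 2 + r)) * \<alpha> r = fold_int (theta_term (s ^ (4 * k + 2)) s) r" for r
      unfolding theta_term_eq_pent[symmetric] \<alpha>_def assms(2)[symmetric] by (simp flip: power_mult add: mult.assoc)
    moreover have "s ^ (4 * k + 2) * s = s ^ (3 + 4 * k)" "q ^ (1 + 2 * k) = s ^ (4 * k + 2)"
      unfolding assms(2)[symmetric] power_Suc2[symmetric] power_mult[symmetric]
      by (intro arg_cong[where f = "\<lambda>e. s ^ e"]; simp)+
    moreover have "norm (s ^ (4 * k + 2)) < 1"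
      unfolding norm_power using s power_strict_decreasing[of 0 "4 * k + 2" "norm s"]
      by (cases "s = 0") auto
    ultimately show ?thesis
      using jacobi_triple_product[of "s ^ (4 * k + 2)" s] s by (simp add: qpoch_inf_list_def)
  qed
  moreover have "bailey_pair q \<alpha> \<beta>"
    unfolding \<alpha>_def \<beta>_def[abs_def] by (rule bailey_pair_pentagonal[OF assms(1,2)])
  \<comment> \<open>for \<open>k = 0\<close> the exponent comparison exhibits \<open>\<alpha>\<close> itself as a theta series, with \<open>x = s\<^sup>2\<close>\<close>
  moreover have "summable (\<lambda>r. norm (\<alpha> r))"
    using summable_norm_theta[of "s ^ 2" s] theta_term_eq_pent[of s 0] q s assms(2)
    by (simp add: \<alpha>_def power2_eq_square)
  ultimately have "(bailey_chain_term q k \<beta> has_sum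
      qpoch_inf_list [s, q ^ (1 + 2 * k), s ^ (3 + 4 * k)] (s ^ (3 + 4 * k)) / qpoch_inf q q) ({1..k} \<rightarrow>\<^sub>E UNIV)"
    using bailey_chain_has_sum[OF q, of \<alpha> \<beta> "C * D" k] \<beta> assms(3) by simp
  then have outer: "((\<lambda>n. qpoch_inf (- s) q * bailey_chain_term q k \<beta> n) has_sum ?S) ({1..k} \<rightarrow>\<^sub>E UNIV)"
    using has_sum_cmult_right by fastforce
  have "(\<lambda>x. ?f x) summable_on (UNIV \<times> ({1..k} \<rightarrow>\<^sub>E UNIV))"
  proof (rule abs_summable_summable, rule Infinite_Sum.abs_summable_on_comparison_test')
    have "(\<lambda>m. norm (a s m)) summable_on UNIV"
      using euler_qexp(2)[OF q s] by (simp add: a_def summable_on_UNIV_nonneg_real_iff)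
    moreover have "(\<lambda>n. norm (bailey_chain_term q k \<gamma> n)) summable_on ({1..k} \<rightarrow>\<^sub>E UNIV)"
      by (rule bailey_chain_term_abs_summable[OF q C])
    ultimately show "(\<lambda>(m, n). norm (a s m) * norm (bailey_chain_term q k \<gamma> n)) summable_on (UNIV \<times> ({1..k} \<rightarrow>\<^sub>E UNIV))"
      by (intro summable_on_SigmaI[where g = "\<lambda>m. norm (a s m) * (\<Sum>\<^sub>\<infinity>n\<in>{1..k} \<rightarrow>\<^sub>E UNIV. norm (bailey_chain_term q k \<gamma> n))"])
         (auto intro!: has_sum_cmult_right summable_on_cmult_left)
    fix x assume "x \<in> (UNIV :: nat set) \<times> ({1..k} \<rightarrow>\<^sub>E (UNIV :: nat set))"
    obtain m n where x: "x = (m, n)" by (cases x)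
    have "norm (a (s * q ^ (n k + 1)) m) = norm ((q ^ (n k + 1)) ^ m) * norm (a s m)"
      by (simp add: a_def norm_mult norm_divide norm_power power_mult_distrib)
    also have "\<dots> \<le> 1 * norm (a s m)"
      unfolding norm_power using q by (intro mult_right_mono power_le_one zero_le_power) auto
    finally show "norm (?f x) \<le> (\<lambda>(m, n). norm (a s m) * norm (bailey_chain_term q k \<gamma> n)) x"
      unfolding x f prod.case by (simp add: norm_mult mult_right_mono)
  qed
  then have "(\<lambda>(n, m). ?f (m, n)) summable_on (({1..k} \<rightarrow>\<^sub>E UNIV) \<times> UNIV)"
    by (subst (asm) summable_on_swap)
  then have "((\<lambda>(n, m). ?f (m, n)) has_sum ?S) (({1..k} \<rightarrow>\<^sub>E UNIV) \<times> UNIV)"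
    by (intro has_sum_SigmaI[OF _ outer]) (use inner in auto)
  then show ?thesis
    by (subst has_sum_swap)
qed

end
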